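(* Let $f:(A,d)\rightarrow(B,d)$ be a morphism of cdga's with Poincaré duality in dimensions $m$ and $n$ respectively. If $f$ is surjective, then there exists a morphism of $A$-modules $f_!: B\rightarrow A$ such that $$\pi_A\circ f_! = f^{\#}\circ \pi_B : B\rightarrow A^{\#}.$$
   Context: All vector spaces are over $\mathbb{Q}$. A cdga is a commutative differential graded algebra $A=\oplus_{p\ge0}A^p$ with differential of degree $+1$. A cdga $(A,d)$ has Poincaré duality in dimension $n$ (is a Poincaré algebra of formal dimension $n$) if $A$ is connected and there is a linear map $\epsilon_A:A^n\to\mathbb{Q}$ with $\epsilon_A(dA^{n-1})=0$ such that the bilinear forms $A^k\otimes A^{n-k}\to\mathbb{Q}$, $x\otimes y\mapsto\epsilon_A(xy)$, are non-degenerate. Such algebras are taken of finite type, hence finite dimensional. Write $A^{\#}=\mathrm{Hom}(A,\mathbb{Q})$; $\pi_A:A\to A^{\#}$ is the isomorphism of $A$-modules $\pi_A(a)(z)=\epsilon_A(az)$ (with $\epsilon_A$ extended by $0$ to the other degrees), and similarly $\pi_B:B\to B^{\#}$. The map $f^{\#}:B^{\#}\to A^{\#}$ is $f^{\#}(\varphi)=\varphi\circ f$. $B$ is an $A$-module via $a*b=f(a)b$. Morphisms of $A$-modules are understood in the usual graded sense (with Koszul signs for maps of nonzero degree); $f_!$ is homogeneous of degree $m-n$. *)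

theory Defs
  imports Complex_Main
begin

text \<open>
  Gradings are indexed by the integers, so that maps of negative degree and the pairing
  of \<open>A\<^sup>k\<close> with \<open>A\<^sup>n\<^sup>-\<^sup>k\<close> make sense for every \<open>k\<close>.  The underlying additive group (or ring) is
  that of the type; scalar multiplication, homogeneous components and differential are
  recorded explicitly.
\<close>

record 'v dg_space =
  smul :: "rat \<Rightarrow> 'v \<Rightarrow> 'v"
  component :: "int \<Rightarrow> 'v set"
  diff :: "'v \<Rightarrow> 'v"

locale dg_vector_space =
  fixes V :: "'v::ab_group_add dg_space"
  assumes vector_space_smul: "vector_space (smul V)"
    and subspace_comp: "module.subspace (smul V) (component V p)"
    and direct_sum: "\<exists>!c. (\<forall>p. c p \<in> component V p) \<and> finite {p. c p \<noteq> 0} \<and> x = (\<Sum>p | c p \<noteq> 0. c p)"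
    and linear_diff: "Vector_Spaces.linear (smul V) (smul V) (diff V)"
    and diff_comp: "x \<in> component V p \<Longrightarrow> diff V x \<in> component V (p + 1)"
    and diff_diff: "diff V (diff V x) = 0"

locale cdga = dg_vector_space A for A :: "'a::ring_1 dg_space" +
  assumes smul_mult_left: "smul A r x * y = smul A r (x * y)"
    and smul_mult_right: "x * smul A r y = smul A r (x * y)"
    and comp_neg: "p < 0 \<Longrightarrow> component A p = {0}"
    and one_comp: "1 \<in> component A 0"
    and mult_comp: "x \<in> component A p \<Longrightarrow> y \<in> component A q \<Longrightarrow> x * y \<in> component A (p + q)"
    and graded_commute:
      "x \<in> component A p \<Longrightarrow> y \<in> component A q \<Longrightarrow> x * y = smul A ((-1) powi (p * q)) (y * x)"
    and leibniz:
      "x \<in> component A p \<Longrightarrow> diff A (x * y) = diff A x * y + smul A ((-1) powi p) (x * diff A y)"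

locale cdga_hom = A: cdga A + B: cdga B
  for A :: "'a::ring_1 dg_space" and B :: "'b::ring_1 dg_space" +
  fixes f :: "'a \<Rightarrow> 'b"
  assumes linear: "Vector_Spaces.linear (smul A) (smul B) f"
    and map_comp: "x \<in> component A p \<Longrightarrow> f x \<in> component B p"
    and map_one: "f 1 = 1"
    and map_mult: "f (x * y) = f x * f y"
    and map_diff: "f (diff A x) = diff B (f x)"

definition nondegenerate :: "'a::zero set \<Rightarrow> 'b::zero set \<Rightarrow> ('a \<Rightarrow> 'b \<Rightarrow> rat) \<Rightarrow> bool" where
  "nondegenerate V W \<beta> \<longleftrightarrow>
     (\<forall>x\<in>V. (\<forall>y\<in>W. \<beta> x y = 0) \<longrightarrow> x = 0) \<and> (\<forall>y\<in>W. (\<forall>x\<in>V. \<beta> x y = 0) \<longrightarrow> y = 0)"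

text \<open>
  The orientation \<open>\<epsilon>\<close> is a functional on all of \<open>A\<close>: it is the given linear map on \<open>A\<^sup>n\<close>, extended
  by zero to the other degrees.  Nondegeneracy for \<open>k > n\<close> forces \<open>A\<^sup>k = 0\<close>, because then
  \<open>A\<^sup>n\<^sup>-\<^sup>k = 0\<close>.
\<close>

locale poincare_cdga = cdga A for A :: "'a::ring_1 dg_space" +
  fixes n :: nat and \<epsilon> :: "'a \<Rightarrow> rat"
  assumes connected: "component A 0 = range (\<lambda>r. smul A r 1)"
    and finite_type: "\<exists>S. finite S \<and> component A p = module.span (smul A) S"
    and linear_orientation: "Vector_Spaces.linear (smul A) (*) \<epsilon>"
    and orientation_other: "x \<in> component A p \<Longrightarrow> p \<noteq> int n \<Longrightarrow> \<epsilon> x = 0"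
    and orientation_diff: "x \<in> component A (int n - 1) \<Longrightarrow> \<epsilon> (diff A x) = 0"
    and nondegenerate: "nondegenerate (component A k) (component A (int n - k)) (\<lambda>x y. \<epsilon> (x * y))"

text \<open>
  Left differential graded modules over a cdga, and their morphisms of degree \<open>k\<close>.  Following the
  Koszul rule, a morphism \<open>g\<close> of degree \<open>k\<close> satisfies \<open>g (a v) = (-1)\<^sup>k\<^sup>p a (g v)\<close> for \<open>a\<close> of degree \<open>p\<close>, and
  \<open>g d = (-1)\<^sup>k d g\<close>.
\<close>

locale dg_module = A: cdga A + M: dg_vector_space M
  for A :: "'a::ring_1 dg_space" and M :: "'m::ab_group_add dg_space" +
  fixes act :: "'a \<Rightarrow> 'm \<Rightarrow> 'm"
  assumes linear_act_left: "Vector_Spaces.linear (smul A) (smul M) (\<lambda>a. act a v)"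
    and linear_act_right: "Vector_Spaces.linear (smul M) (smul M) (act a)"
    and act_one: "act 1 v = v"
    and act_mult: "act (a * b) v = act a (act b v)"
    and act_comp: "a \<in> component A p \<Longrightarrow> v \<in> component M q \<Longrightarrow> act a v \<in> component M (p + q)"
    and act_diff: "a \<in> component A p \<Longrightarrow>
      diff M (act a v) = act (diff A a) v + smul M ((-1) powi p) (act a (diff M v))"

locale dg_module_hom = M: dg_module A M actM + N: dg_module A N actN
  for A :: "'a::ring_1 dg_space"
    and M :: "'m::ab_group_add dg_space" and actM :: "'a \<Rightarrow> 'm \<Rightarrow> 'm"
    and N :: "'n::ab_group_add dg_space" and actN :: "'a \<Rightarrow> 'n \<Rightarrow> 'n" +
  fixes k :: int and g :: "'m \<Rightarrow> 'n"
  assumes linear: "Vector_Spaces.linear (smul M) (smul N) g"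
    and map_comp: "v \<in> component M q \<Longrightarrow> g v \<in> component N (q + k)"
    and map_act: "a \<in> component A p \<Longrightarrow> g (actM a v) = smul N ((-1) powi (k * p)) (actN a (g v))"
    and map_diff: "g (diff M v) = smul N ((-1) powi k) (diff N (g v))"

definition pullback_act :: "('a \<Rightarrow> 'b) \<Rightarrow> 'a \<Rightarrow> 'b \<Rightarrow> 'b::times" where
  "pullback_act f a b = f a * b"

text \<open>
  Elements of \<open>Hom(A, \<rat>)\<close> are represented as functions from the type of \<open>A\<close> to \<open>rat\<close>.
\<close>

definition poincare_map :: "('a::times \<Rightarrow> rat) \<Rightarrow> 'a \<Rightarrow> 'a \<Rightarrow> rat" where
  "poincare_map \<epsilon> a = (\<lambda>z. \<epsilon> (a * z))"

definition dual_map :: "('a \<Rightarrow> 'b) \<Rightarrow> ('b \<Rightarrow> rat) \<Rightarrow> 'a \<Rightarrow> rat" where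
  "dual_map f \<phi> = \<phi> \<circ> f"

lemma (in cdga) regular_dg_module: "dg_module A A (*)"
proof -
  interpret vector_space "smul A" by (rule vector_space_smul)
  interpret P: vector_space_pair "smul A" "smul A" by unfold_locales
  show ?thesis
  proof unfold_locales
  qed (auto simp: algebra_simps smul_mult_left smul_mult_right leibniz mult_comp)
qed

lemma (in cdga_hom) pullback_dg_module: "dg_module A B (pullback_act f)"
proof -
  interpret VA: vector_space "smul A" by (rule A.vector_space_smul)
  interpret VB: vector_space "smul B" by (rule B.vector_space_smul)
  interpret F: Vector_Spaces.linear "smul A" "smul B" f by (rule linear)
  show ?thesis
  proof unfold_locales
  qed (auto simp: pullback_act_def algebra_simps F.add F.scale map_one map_mult map_diff
        B.smul_mult_left B.smul_mult_right B.leibniz[OF map_comp] B.mult_comp map_comp)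
qed

end

theory Submission imports Defs begin

text \<open>
  Poincare duality says that \<open>(x, y) \<mapsto> \<epsilon>\<^sub>A (x y)\<close> is a nondegenerate pairing on a finite dimensional
  space, so every linear functional on \<open>A\<close> is \<open>\<epsilon>\<^sub>A (x \<cdot> _)\<close> for exactly one \<open>x\<close>
  (\<open>functional_representable\<close>, \<open>pairing_nondegenerate\<close>).  Hence the equation
  \<open>\<epsilon>\<^sub>A (f\<^sub>! b \<cdot> z) = \<epsilon>\<^sub>B (b \<cdot> f z)\<close> for all \<open>z\<close> defines a map \<open>f\<^sub>!\<close>, and the identity
  \<open>\<pi>\<^sub>A \<circ> f\<^sub>! = f\<^sup># \<circ> \<pi>\<^sub>B\<close> holds by construction.  Linearity and compatibility with the action and
  the differential are identities in \<open>A\<close>, so they may be checked after pairing with an arbitrary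
  \<open>z\<close>; linearity is then immediate.  For \<open>b\<close> of degree \<open>q\<close>, the functional
  \<open>z \<mapsto> \<epsilon>\<^sub>B (b \<cdot> f z)\<close> lives on degree \<open>n - q\<close>, which forces \<open>f\<^sub>! b\<close> to have degree
  \<open>m - (n - q)\<close>.

  Let \<open>k = m - n\<close>, and let \<open>a\<close> have degree \<open>p\<close>.  Moving \<open>f a\<close> past \<open>b\<close> in \<open>B\<close> costs \<open>(-1)\<^sup>p\<^sup>q\<close>, and
  moving \<open>a\<close> back past \<open>f\<^sub>! b\<close> in \<open>A\<close> costs \<open>(-1)\<close> to the power \<open>p (q + k)\<close>; the product of the two
  is the Koszul sign \<open>(-1)\<^sup>k\<^sup>p\<close> of the module structure.  Likewise, as the orientations vanish on
  boundaries, the Leibniz rule makes \<open>d\<close> self-adjoint up to sign for both pairings, with signs \<open>-(-1)\<^sup>q\<close> in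
  \<open>B\<close> and \<open>-(-1)\<close> to the power \<open>q + k\<close> in \<open>A\<close>, whose product is \<open>(-1)\<^sup>k\<close>.
\<close>

section \<open>Linear algebra\<close>

lemma (in vector_space_pair) linearI:
  assumes "\<And>x y. g (x + y) = g x + g y" and "\<And>r x. g (s1 r x) = s2 r (g x)"
  shows "Vector_Spaces.linear s1 s2 g"
  using assms vs1.vector_space_axioms vs2.vector_space_axioms
  by (simp add: Vector_Spaces.linear_iff)

text \<open>
  Expanding the functionals \<open>\<beta> x\<close> in the basis dual to a basis \<open>Bs\<close>, and identifying the two bases,
  turns \<open>\<beta>\<close>, as a map from the space to its dual, into the endomorphism
  \<open>x \<mapsto> \<Sum>b\<in>Bs. \<beta> x b \<cdot> b\<close>.  For an endomorphism in finite dimension, injectivity gives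
  surjectivity.
\<close>

lemma functional_representable_by_form:
  fixes s :: "'k::field \<Rightarrow> 'v::ab_group_add \<Rightarrow> 'v"
  assumes V: "vector_space s"
    and fin: "finite S" and spans: "module.span s S = UNIV"
    and left: "\<And>y. Vector_Spaces.linear s (*) (\<lambda>x. \<beta> x y)"
    and right: "\<And>x. Vector_Spaces.linear s (*) (\<beta> x)"
    and nondeg: "\<And>x. (\<And>y. \<beta> x y = 0) \<Longrightarrow> x = 0"
    and phi: "Vector_Spaces.linear s (*) \<phi>"
  shows "\<exists>x. \<forall>y. \<beta> x y = \<phi> y"
proof -
  interpret vector_space s by (rule V)
  obtain Bs where Bs: "Bs \<subseteq> S" "independent Bs" "span Bs = UNIV"
    using maximal_independent_subset[of S] spans
    by (metis span_mono span_span top.extremum_uniqueI)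
  have finB: "finite Bs" using Bs(1) fin finite_subset by blast
  interpret F: finite_dimensional_vector_space s Bs
    using finB Bs by unfold_locales auto
  interpret K: vector_space_pair s "(*) :: 'k \<Rightarrow> 'k \<Rightarrow> 'k"
    using left[of 0] unfolding Vector_Spaces.linear_def vector_space_pair_def by blast
  interpret P: vector_space_pair s s by unfold_locales
  define L where "L = (\<lambda>x. \<Sum>b\<in>Bs. s (\<beta> x b) b)"
  have linL: "Vector_Spaces.linear s s L"
    unfolding L_def using K.linear_add[OF left] K.linear_scale[OF left]
    by (intro P.linearI) (auto simp: scale_left_distrib sum.distrib scale_sum_right)
  have coeff: "u b = v b" if "(\<Sum>b\<in>Bs. s (u b) b) = (\<Sum>b\<in>Bs. s (v b) b)" "b \<in> Bs"
    for u v :: "'v \<Rightarrow> 'k" and b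
  proof -
    have "(\<Sum>b\<in>Bs. s (u b - v b) b) = 0"
      using that(1) by (simp add: scale_left_diff_distrib sum_subtractf)
    then show ?thesis
      using independentD[OF Bs(2) finB order_refl, of "\<lambda>b. u b - v b" b] that(2) by simp
  qed
  have eqI: "\<beta> x y = \<psi> y"
    if "Vector_Spaces.linear s (*) \<psi>" "\<And>b. b \<in> Bs \<Longrightarrow> \<beta> x b = \<psi> b" for x y \<psi>
    using K.linear_eq_on[OF right that(1), of y Bs x] that(2) Bs(3) by auto
  have "inj L"
  proof (rule P.linear_inj_iff_eq_0[OF linL, THEN iffD2], intro allI impI)
    fix x assume "L x = 0"
    then have "\<beta> x b = 0" if "b \<in> Bs" for b
      using coeff[of "\<beta> x" "\<lambda>_. 0" b] that unfolding L_def by simp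
    then show "x = 0"
      using eqI[OF K.module_hom_zero] nondeg by simp
  qed
  then have "surj L"
    using F.linear_inj_imp_surj[OF linL] by simp
  then obtain x where "L x = (\<Sum>b\<in>Bs. s (\<phi> b) b)" by (metis surjD)
  then have "\<beta> x b = \<phi> b" if "b \<in> Bs" for b
    using coeff[of "\<beta> x" \<phi> b] that unfolding L_def by simp
  then show ?thesis using eqI[OF phi] by blast
qed

section \<open>Homogeneous elements and the Poincare pairing\<close>

lemma (in dg_vector_space) homogeneous_induct:
  assumes zero: "P 0" and add: "\<And>x y. P x \<Longrightarrow> P y \<Longrightarrow> P (x + y)"
    and homogeneous: "\<And>x p. x \<in> component V p \<Longrightarrow> P x"
  shows "P x"
proof -
  obtain c where c: "\<And>p. c p \<in> component V p" and x: "x = (\<Sum>p | c p \<noteq> 0. c p)"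
    using direct_sum[of x] by blast
  have "P (sum c I)" for I
    by (induction I rule: infinite_finite_induct) (auto intro: zero add homogeneous[OF c])
  then show ?thesis unfolding x .
qed

context poincare_cdga
begin

sublocale vector_space "smul A" by (rule vector_space_smul)

sublocale pair: vector_space_pair "smul A" "(*) :: rat \<Rightarrow> rat \<Rightarrow> rat"
  using linear_orientation unfolding Vector_Spaces.linear_def vector_space_pair_def by blast

sublocale orientation: Vector_Spaces.linear "smul A" "(*)" \<epsilon>
  by (rule linear_orientation)

lemma zero_mem_component: "0 \<in> component A p"
  using subspace_0[OF subspace_comp] .

lemma orientation_boundary: "\<epsilon> (diff A x) = 0"
proof (induction x rule: homogeneous_induct)
  interpret D: Vector_Spaces.linear "smul A" "smul A" "diff A" by (rule linear_diff)
  show "\<epsilon> (diff A 0) = 0" by (simp add: D.zero orientation.zero)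
  show "\<epsilon> (diff A (x + y)) = 0" if "\<epsilon> (diff A x) = 0" "\<epsilon> (diff A y) = 0" for x y
    using that by (simp add: D.add orientation.add)
  show "\<epsilon> (diff A x) = 0" if "x \<in> component A p" for x p
  proof (cases "p = int n - 1")
    case True
    then show ?thesis using orientation_diff that by simp
  next
    case False
    then show ?thesis using orientation_other[OF diff_comp[OF that]] by simp
  qed
qed

lemma pairing_of_decomposition:
  assumes c: "\<And>q. c q \<in> component A q" and fin: "finite {q. c q \<noteq> 0}"
    and y: "y \<in> component A (int n - p)"
  shows "\<epsilon> ((\<Sum>q | c q \<noteq> 0. c q) * y) = \<epsilon> (c p * y)"
proof -
  have other: "\<epsilon> (c q * y) = 0" if "q \<noteq> p" for q
    using orientation_other[OF mult_comp[OF c[of q] y]] that by simp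
  have "\<epsilon> ((\<Sum>q | c q \<noteq> 0. c q) * y) = (\<Sum>q | c q \<noteq> 0. \<epsilon> (c q * y))"
    by (simp add: sum_distrib_right orientation.sum)
  also have "\<dots> = (\<Sum>q | c q \<noteq> 0. if q = p then \<epsilon> (c p * y) else 0)"
    by (rule sum.cong) (auto simp: other)
  also have "\<dots> = \<epsilon> (c p * y)"
    using fin by (auto simp: orientation.zero)
  finally show ?thesis .
qed

text \<open>
  The component of \<open>x\<close> in a degree \<open>q \<noteq> p\<close> pairs with \<open>A\<^sup>n\<^sup>-\<^sup>q\<close> as \<open>x\<close> itself does, hence
  trivially, and nondegeneracy removes it.
\<close>

lemma mem_component_if_pairing_vanishes:
  assumes vanish: "\<And>r y. r \<noteq> int n - p \<Longrightarrow> y \<in> component A r \<Longrightarrow> \<epsilon> (x * y) = 0"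
  shows "x \<in> component A p"
proof -
  obtain c where c: "\<And>q. c q \<in> component A q" and fin: "finite {q. c q \<noteq> 0}"
    and x: "x = (\<Sum>q | c q \<noteq> 0. c q)"
    using direct_sum[of x] by blast
  have zero: "c q = 0" if "q \<noteq> p" for q
  proof -
    have "\<epsilon> (c q * y) = 0" if y: "y \<in> component A (int n - q)" for y
      using pairing_of_decomposition[OF c fin y] vanish[OF _ y] \<open>q \<noteq> p\<close> unfolding x by simp
    then show ?thesis
      using nondegenerate[of q] c[of q] unfolding nondegenerate_def by blast
  qed
  then have "{q. c q \<noteq> 0} \<subseteq> {p}" by blast
  then have "{q. c q \<noteq> 0} = {} \<or> {q. c q \<noteq> 0} = {p}" by blast
  then show ?thesis using c[of p] zero_mem_component unfolding x by auto
qed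

lemma pairing_nondegenerate:
  assumes "\<And>y. \<epsilon> (x * y) = 0"
  shows "x = 0"
proof -
  \<comment> \<open>Such an \<open>x\<close> lies in every component, and the one of degree \<open>-1\<close> vanishes.\<close>
  have "x \<in> component A (-1)" using mem_component_if_pairing_vanishes assms by blast
  then show ?thesis using comp_neg[of "-1"] by simp
qed

lemma pairing_eqI:
  assumes "\<And>z. \<epsilon> (x * z) = \<epsilon> (y * z)"
  shows "x = y"
  using pairing_nondegenerate[of "x - y"] assms by (simp add: left_diff_distrib orientation.diff)

lemma component_above_dimension:
  assumes "p > int n"
  shows "component A p = {0}"
proof -
  have "component A (int n - p) = {0}" using comp_neg assms by simp
  then show ?thesis
    using nondegenerate[of p] zero_mem_component[of p]
    unfolding nondegenerate_def by (auto simp: orientation.zero)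
qed

lemma finite_spanning_set: "\<exists>S. finite S \<and> span S = UNIV"
proof -
  obtain S where S: "\<And>p. finite (S p)" "\<And>p. component A p = span (S p)"
    using finite_type by metis
  let ?S = "\<Union>p\<in>{0..int n}. S p"
  have "x \<in> span ?S" for x
  proof (induction x rule: homogeneous_induct)
    fix x p assume x: "x \<in> component A p"
    show "x \<in> span ?S"
    proof (cases "p \<in> {0..int n}")
      case True
      then have "span (S p) \<subseteq> span ?S" by (intro span_mono) blast
      then show ?thesis using x S(2) by blast
    next
      case False
      then have "x = 0" using x comp_neg[of p] component_above_dimension[of p] by force
      then show ?thesis by (simp add: span_zero)
    qed
  qed (auto intro: span_zero span_add)
  then show ?thesis using S(1) by (intro exI[of _ ?S]) auto
qed

lemma functional_representable:
  assumes "Vector_Spaces.linear (smul A) (*) \<phi>"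
  shows "\<exists>x. \<forall>y. \<epsilon> (x * y) = \<phi> y"
proof -
  obtain S where S: "finite S" "span S = UNIV" using finite_spanning_set by blast
  show ?thesis
  proof (rule functional_representable_by_form[OF vector_space_smul S _ _ _ assms])
    show "Vector_Spaces.linear (smul A) (*) (\<lambda>x. \<epsilon> (x * y))" for y
      by (intro pair.linearI)
        (simp_all add: distrib_right smul_mult_left orientation.add orientation.scale)
    show "Vector_Spaces.linear (smul A) (*) (\<lambda>y. \<epsilon> (x * y))" for x
      by (intro pair.linearI)
        (simp_all add: distrib_left smul_mult_right orientation.add orientation.scale)
  qed (rule pairing_nondegenerate)
qed

text \<open>This is integration by parts: the boundary \<open>d (x y)\<close> has orientation zero.\<close>

lemma pairing_diff:
  assumes "x \<in> component A p"
  shows "\<epsilon> (diff A x * y) = - ((-1) powi p * \<epsilon> (x * diff A y))"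
  using orientation_boundary[of "x * y"] leibniz[OF assms, of y]
  by (simp add: orientation.add orientation.scale)

lemma pairing_commute:
  assumes "x \<in> component A p" "y \<in> component A q"
  shows "\<epsilon> (x * y * z) = (-1) powi (p * q) * \<epsilon> (y * x * z)"
  using graded_commute[OF assms] by (simp add: smul_mult_left orientation.scale)

end

section \<open>The shriek map\<close>

theorem proposition7:
  fixes A :: "'a::ring_1 dg_space" and B :: "'b::ring_1 dg_space"
    and m n :: nat
    and \<epsilon>\<^sub>A :: "'a \<Rightarrow> rat" and \<epsilon>\<^sub>B :: "'b \<Rightarrow> rat"
    and f :: "'a \<Rightarrow> 'b"
  assumes "poincare_cdga A m \<epsilon>\<^sub>A"
    and "poincare_cdga B n \<epsilon>\<^sub>B"
    and "cdga_hom A B f"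
    and "surj f"
  shows "\<exists>f_shriek :: 'b \<Rightarrow> 'a.
    dg_module_hom A B (pullback_act f) A (*) (int m - int n) f_shriek \<and>
    poincare_map \<epsilon>\<^sub>A \<circ> f_shriek = dual_map f \<circ> poincare_map \<epsilon>\<^sub>B"
proof -
  interpret A: poincare_cdga A m \<epsilon>\<^sub>A by fact
  interpret B: poincare_cdga B n \<epsilon>\<^sub>B by fact
  interpret f: cdga_hom A B f by fact
  interpret lf: Vector_Spaces.linear "smul A" "smul B" f by (rule f.linear)
  interpret dA: Vector_Spaces.linear "smul A" "smul A" "diff A" by (rule A.linear_diff)
  interpret dB: Vector_Spaces.linear "smul B" "smul B" "diff B" by (rule B.linear_diff)
  interpret BA: vector_space_pair "smul B" "smul A" by unfold_locales
  define k where "k = int m - int n"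

  have "Vector_Spaces.linear (smul A) (*) (\<lambda>z. \<epsilon>\<^sub>B (b * f z))" for b
    by (intro A.pair.linearI)
      (simp_all add: lf.add lf.scale distrib_left B.smul_mult_right
        B.orientation.add B.orientation.scale)
  then have "\<forall>b. \<exists>x. \<forall>z. \<epsilon>\<^sub>A (x * z) = \<epsilon>\<^sub>B (b * f z)"
    by (intro allI A.functional_representable)
  then obtain g where g: "\<And>b z. \<epsilon>\<^sub>A (g b * z) = \<epsilon>\<^sub>B (b * f z)" by metis

  have lin_g: "Vector_Spaces.linear (smul B) (smul A) g"
    by (intro BA.linearI; rule A.pairing_eqI)
      (simp_all add: g distrib_right A.smul_mult_left B.smul_mult_left
        A.orientation.add B.orientation.add A.orientation.scale B.orientation.scale)
  interpret lg: Vector_Spaces.linear "smul B" "smul A" g by (rule lin_g)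

  have deg_g: "g b \<in> component A (q + k)" if b: "b \<in> component B q" for b q
  proof (rule A.mem_component_if_pairing_vanishes)
    fix r z assume r: "r \<noteq> int m - (q + k)" and z: "z \<in> component A r"
    have "q + r \<noteq> int n" using r unfolding k_def by simp
    then show "\<epsilon>\<^sub>A (g b * z) = 0"
      unfolding g using B.orientation_other[OF B.mult_comp[OF b f.map_comp[OF z]]] by simp
  qed

  have act_g: "g (f a * b) = smul A ((-1) powi (k * p)) (a * g b)"
    if a: "a \<in> component A p" for a b p
  proof (induction b rule: B.homogeneous_induct)
    fix b q assume b: "b \<in> component B q"
    show "g (f a * b) = smul A ((-1) powi (k * p)) (a * g b)"
    proof (rule A.pairing_eqI)
      fix z
      have sign: "(-1) powi (p * q) * (-1) powi ((q + k) * p) = ((-1) powi (k * p) :: rat)"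
        by (simp add: power_int_minus_one_minus power_int_minus_left algebra_simps)
      have "\<epsilon>\<^sub>A (g (f a * b) * z) = (-1) powi (p * q) * \<epsilon>\<^sub>A (g b * a * z)"
        using B.pairing_commute[OF f.map_comp[OF a] b]
        by (simp add: g f.map_mult mult.assoc)
      also have "\<dots> = (-1) powi (p * q) * ((-1) powi ((q + k) * p) * \<epsilon>\<^sub>A (a * g b * z))"
        by (simp only: A.pairing_commute[OF deg_g[OF b] a])
      also have "\<dots> = (-1) powi (k * p) * \<epsilon>\<^sub>A (a * g b * z)"
        by (simp only: sign mult.assoc[symmetric])
      finally show "\<epsilon>\<^sub>A (g (f a * b) * z) = \<epsilon>\<^sub>A (smul A ((-1) powi (k * p)) (a * g b) * z)"
        by (simp add: A.smul_mult_left A.orientation.scale)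
    qed
  qed (simp_all add: lg.zero lg.add distrib_left A.scale_right_distrib)

  have diff_g: "g (diff B b) = smul A ((-1) powi k) (diff A (g b))" for b
  proof (induction b rule: B.homogeneous_induct)
    fix b q assume b: "b \<in> component B q"
    show "g (diff B b) = smul A ((-1) powi k) (diff A (g b))"
    proof (rule A.pairing_eqI)
      fix z
      have sign: "(-1) powi k * (-1) powi (q + k) = ((-1) powi q :: rat)"
        by (simp add: power_int_minus_left)
      have "\<epsilon>\<^sub>A (g (diff B b) * z) = - ((-1) powi q * \<epsilon>\<^sub>A (g b * diff A z))"
        by (simp add: g B.pairing_diff[OF b] f.map_diff)
      also have "\<dots> = (-1) powi k * \<epsilon>\<^sub>A (diff A (g b) * z)"
        by (simp add: A.pairing_diff[OF deg_g[OF b]] sign[symmetric])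
      finally show "\<epsilon>\<^sub>A (g (diff B b) * z) = \<epsilon>\<^sub>A (smul A ((-1) powi k) (diff A (g b)) * z)"
        by (simp add: A.smul_mult_left A.orientation.scale)
    qed
  qed (simp_all add: lg.zero lg.add dA.zero dA.add dB.zero dB.add A.scale_right_distrib)

  have "dg_module_hom A B (pullback_act f) A (*) k g"
    using f.pullback_dg_module A.regular_dg_module lin_g deg_g act_g diff_g
    by (simp add: dg_module_hom_def dg_module_hom_axioms_def pullback_act_def)
  moreover have "poincare_map \<epsilon>\<^sub>A \<circ> g = dual_map f \<circ> poincare_map \<epsilon>\<^sub>B"
    by (auto simp: fun_eq_iff poincare_map_def dual_map_def g)
  ultimately show ?thesis unfolding k_def by blast
qed

end
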